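(* Let $\phi$ be a sign-normalized rank-two Drinfeld $\mathbf A$-module over $L$ with $\phi_x=\theta+g_1\tau+g_2\tau^2+g_3\tau^3+\tau^4$ and $\phi_y=\eta+h_1\tau+h_2\tau^2+h_3\tau^3+h_4\tau^4+h_5\tau^5+\tau^6$. Put $$P_0=h_4-g_2^{q^2}-(h_5-g_3^{q^2})g_3^q,\qquad P_3=h_3-g_1^{q^2}-(h_5-g_3^{q^2})g_2^q-P_0g_3 ,$$ and assume $P_3\neq0$. Then in the Anderson motive $M_\phi=L\{\tau\}\cdot\mathbf s_\phi$ there is a nontrivial relation $$C_2\,\tau^2\mathbf s_\phi=C_1\,\tau\mathbf s_\phi+C_0\,\mathbf s_\phi$$ with $C_0\in\langle xy,x^2,y,x,1\rangle_L$, $C_1\in\langle x^2,y,x,1\rangle_L$, $C_2\in\langle x^2,x,1\rangle_L$, where $\langle\cdots\rangle_L$ denotes the $L$-span of the listed monomials.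
   Context: Let $q$ be a prime power and $E: y^2+a_1xy+a_3y=x^3+a_2x^2+a_4x+a_6$ ($a_i\in\mathbb F_q$) an elliptic curve with point at infinity $\infty$; $\mathbf A=\mathbb F_q[x,y]$ is its coordinate ring. Let $\mathbb K=\mathbb F_q(\theta,\eta)$ be an isomorphic copy of $\mathbb F_q(x,y)$ via $x\mapsto\theta,\ y\mapsto\eta$; $L$ is an algebraically closed field containing $\mathbb K$; $\mathbf A_L=L\otimes_{\mathbb F_q}\mathbf A$. $L\{\tau\}$ is the twisted polynomial ring with $\tau c=c^q\tau$. A sign-normalized rank-two Drinfeld $\mathbf A$-module over $L$ is an $\mathbb F_q$-algebra homomorphism $\phi:\mathbf A\to L\{\tau\}$ with $\phi_x,\phi_y$ of the displayed form, $g_i,h_j\in L$. Its Anderson motive $M_\phi=L\{\tau\}\cdot\mathbf s_\phi$ is the free left $L\{\tau\}$-module on the formal generator $\mathbf s_\phi$, with $\mathbf A$ acting by $a\cdot(\omega\mathbf s_\phi)=\omega\phi_a\mathbf s_\phi$ (so $x\mathbf s_\phi=\phi_x\mathbf s_\phi$, $y\mathbf s_\phi=\phi_y\mathbf s_\phi$); it is thereby an $\mathbf A_L$-module. *)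

theory Defs
  imports
    "HOL-Library.Cardinality"
    "HOL-Computational_Algebra.Computational_Algebra"
    "HOL-Algebra.QuotRing"
    "HOL-Algebra.Module"
    "HOL-Algebra.Embedded_Algebras"
    "HOL-Algebra.Algebraic_Closure_Type"
begin

section \<open>Weierstrass curves and their affine coordinate rings\<close>

datatype 'a weierstrass =
  Weierstrass (wa1: 'a) (wa2: 'a) (wa3: 'a) (wa4: 'a) (wa6: 'a)

text \<open>The standard discriminant, valid in every characteristic.\<close>

definition wdisc :: "'a::comm_ring_1 weierstrass \<Rightarrow> 'a" where
  "wdisc E =
    (let b2 = wa1 E ^ 2 + 4 * wa2 E;
         b4 = 2 * wa4 E + wa1 E * wa3 E;
         b6 = wa3 E ^ 2 + 4 * wa6 E;
         b8 = wa1 E ^ 2 * wa6 E + 4 * wa2 E * wa6 E - wa1 E * wa3 E * wa4 E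
              + wa2 E * wa3 E ^ 2 - wa4 E ^ 2
     in - (b2 ^ 2 * b8) - 8 * b4 ^ 3 - 27 * b6 ^ 2 + 9 * b2 * b4 * b6)"

definition is_elliptic :: "'a::comm_ring_1 weierstrass \<Rightarrow> bool" where
  "is_elliptic E \<longleftrightarrow> wdisc E \<noteq> 0"

text \<open>Elements of \<open>F[X][Y]\<close> are of type \<open>'a poly poly\<close>: the inner variable is \<open>X\<close>, the outer
  one is \<open>Y\<close>.  The next polynomial is
  \<open>Y\<^sup>2 + (a\<^sub>1 X + a\<^sub>3) Y - (X\<^sup>3 + a\<^sub>2 X\<^sup>2 + a\<^sub>4 X + a\<^sub>6)\<close>.\<close>

definition wpoly :: "'a::comm_ring_1 weierstrass \<Rightarrow> 'a poly poly" where
  "wpoly E = [: - [:wa6 E, wa4 E, wa2 E, 1:], [:wa3 E, wa1 E:], 1 :]"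

abbreviation XY_ring :: "'a::comm_ring_1 poly poly ring" where
  "XY_ring \<equiv> ring_of_type_algebra"

definition coord_ring :: "'a::comm_ring_1 weierstrass \<Rightarrow> 'a poly poly set ring" where
  "coord_ring E = XY_ring Quot (PIdl\<^bsub>XY_ring\<^esub> (wpoly E))"

definition coord_class :: "'a::comm_ring_1 weierstrass \<Rightarrow> 'a poly poly \<Rightarrow> 'a poly poly set" where
  "coord_class E P = (PIdl\<^bsub>XY_ring\<^esub> (wpoly E)) +>\<^bsub>XY_ring\<^esub> P"

definition coord_x :: "'a::comm_ring_1 weierstrass \<Rightarrow> 'a poly poly set" where
  "coord_x E = coord_class E [:[:0, 1:]:]"

definition coord_y :: "'a::comm_ring_1 weierstrass \<Rightarrow> 'a poly poly set" where
  "coord_y E = coord_class E [:0, 1:]"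

definition coord_const :: "'a::comm_ring_1 weierstrass \<Rightarrow> 'a \<Rightarrow> 'a poly poly set" where
  "coord_const E c = coord_class E [:[:c:]:]"


section \<open>Base change to \<open>L\<close>\<close>

text \<open>An embedding into \<open>L\<close> of the function field of \<open>E\<close>, the fraction field of \<open>coord_ring E\<close>,
  is the same thing as an injective ring homomorphism \<open>\<iota>\<close> from \<open>coord_ring E\<close> to \<open>L\<close>; then
  \<open>\<theta> = \<iota> x\<close> and \<open>\<eta> = \<iota> y\<close>, and \<open>\<iota>\<close> on constants is the inclusion of the ground field in \<open>L\<close>.
  The ring \<open>L \<otimes> coord_ring E\<close> is realised as the coordinate ring of the curve with the same
  equation over \<open>L\<close>, that is \<open>L[X,Y] / (wpoly E)\<close>; the tensor \<open>c \<otimes> x\<^sup>j y\<^sup>i\<close> is the class of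
  \<open>c X\<^sup>j Y\<^sup>i\<close>.\<close>

definition base_change ::
  "'k::field weierstrass \<Rightarrow> ('k poly poly set \<Rightarrow> 'l::field) \<Rightarrow> 'l weierstrass" where
  "base_change E \<iota> = map_weierstrass (\<lambda>c. \<iota> (coord_const E c)) E"

abbreviation coord_ring_L ::
  "'k::field weierstrass \<Rightarrow> ('k poly poly set \<Rightarrow> 'l::field) \<Rightarrow> 'l poly poly set ring" where
  "coord_ring_L E \<iota> \<equiv> coord_ring (base_change E \<iota>)"

definition L_span ::
  "'k::field weierstrass \<Rightarrow> ('k poly poly set \<Rightarrow> 'l::field) \<Rightarrow> 'l poly poly set list
    \<Rightarrow> 'l poly poly set set" where
  "L_span E \<iota> ms =
     ring.Span (coord_ring_L E \<iota>) (range (coord_const (base_change E \<iota>))) ms"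


section \<open>Twisted polynomials\<close>

text \<open>The additive group of \<open>L{\<tau>}\<close> is that of \<open>'l poly\<close>, the polynomial with coefficients
  \<open>c\<^sub>i\<close> standing for \<open>\<Sum>i. c\<^sub>i \<tau>\<^sup>i\<close> (coefficients on the left).  The multiplication is not
  the one of the type \<open>'l poly\<close> but is determined by \<open>\<tau> c = c\<^sup>q \<tau>\<close>.\<close>

definition twisted_mult :: "nat \<Rightarrow> 'l::field poly \<Rightarrow> 'l poly \<Rightarrow> 'l poly" where
  "twisted_mult q f g =
     (\<Sum>i\<le>degree f. \<Sum>j\<le>degree g. monom (coeff f i * coeff g j ^ (q ^ i)) (i + j))"

definition twisted_poly_ring :: "nat \<Rightarrow> 'l::field poly ring" where
  "twisted_poly_ring q =
     \<lparr>carrier = UNIV, monoid.mult = twisted_mult q, one = 1, ring.zero = 0, add = (+)\<rparr>"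

definition tau :: "'l::field poly" where
  "tau = [:0, 1:]"


section \<open>Algebra homomorphisms to twisted polynomials and Anderson motives\<close>

definition twisted_algebra_hom ::
  "'k::finite_field weierstrass \<Rightarrow> ('k poly poly set \<Rightarrow> 'l::field) \<Rightarrow> ('k poly poly set \<Rightarrow> 'l poly)
    \<Rightarrow> bool" where
  "twisted_algebra_hom E \<iota> \<phi> \<longleftrightarrow>
     \<phi> \<in> ring_hom (coord_ring E) (twisted_poly_ring CARD('k)) \<and>
     (\<forall>c. \<phi> (coord_const E c) = [:\<iota> (coord_const E c):])"

text \<open>The action of \<open>\<Sum>i j. c\<^sub>i\<^sub>j X\<^sup>j Y\<^sup>i\<close> on \<open>\<omega> s\<close>: a tensor \<open>c \<otimes> a\<close> sends
  \<open>\<omega> s\<close> to \<open>c \<omega> \<phi>\<^sub>a s\<close>.\<close>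

definition motive_act ::
  "'k::finite_field weierstrass \<Rightarrow> ('k poly poly set \<Rightarrow> 'l::field poly) \<Rightarrow> 'l poly poly \<Rightarrow> 'l poly
    \<Rightarrow> 'l poly" where
  "motive_act E \<phi> P \<omega> =
     (\<Sum>i\<le>degree P. \<Sum>j\<le>degree (coeff P i).
        [:coeff (coeff P i) j:] \<otimes>\<^bsub>twisted_poly_ring CARD('k)\<^esub> \<omega>
          \<otimes>\<^bsub>twisted_poly_ring CARD('k)\<^esub>
            \<phi> (coord_x E [^]\<^bsub>coord_ring E\<^esub> j \<otimes>\<^bsub>coord_ring E\<^esub> coord_y E [^]\<^bsub>coord_ring E\<^esub> i))"

text \<open>The free left module \<open>L{\<tau>} s\<close> is identified with \<open>L{\<tau>}\<close> through \<open>\<omega> s \<mapsto> \<omega>\<close>, so the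
  generator \<open>s\<close> is \<open>1\<close> and the left \<open>L{\<tau>}\<close>-action is multiplication in \<open>twisted_poly_ring\<close>.
  For a class \<open>C\<close> modulo \<open>wpoly\<close>, all representatives act in the same way when \<open>\<phi>\<close> is an
  algebra homomorphism, and \<open>C\<close> acts by their common value.  The fields \<open>mult\<close> and \<open>one\<close> of the
  record have no meaning for a module.\<close>

definition anderson_motive ::
  "'k::finite_field weierstrass \<Rightarrow> ('k poly poly set \<Rightarrow> 'l::field poly)
    \<Rightarrow> ('l poly poly set, 'l poly) module" where
  "anderson_motive E \<phi> =
     \<lparr>carrier = UNIV, monoid.mult = undefined, one = undefined, ring.zero = 0, add = (+),
      module.smult = (\<lambda>C \<omega>. the_elem ((\<lambda>P. motive_act E \<phi> P \<omega>) ` C))\<rparr>"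

definition motive_gen :: "'l::field poly" where
  "motive_gen = 1"

end

theory Submission
  imports Defs
begin

text \<open>The motive is \<open>L{\<tau>}\<close>, with \<open>c \<otimes> a\<close> acting by \<open>\<omega> \<mapsto> c \<omega> \<phi>\<^sub>a\<close>, and the relation comes from counting
  dimensions.  As \<open>\<phi>\<^sub>x\<close> and \<open>\<phi>\<^sub>y\<close> have degrees 4 and 6 in \<open>\<tau>\<close>, the product of \<open>x\<^sup>j y\<^sup>i\<close> with
  \<open>\<tau>\<^sup>k s\<close> has degree at most \<open>k + 4 j + 6 i\<close>.  The monomials allowed in \<open>C\<^sub>0\<close>, \<open>C\<^sub>1\<close>, \<open>C\<^sub>2\<close> give
  12 products with \<open>s\<close>, \<open>\<tau> s\<close>, \<open>\<tau>\<^sup>2 s\<close>, all of degree at most 10.  They lie in a space of dimension 11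
  over \<open>L\<close>, acting by multiplication from the left, and so satisfy a nontrivial \<open>L\<close>-linear relation
  (\<open>linear_relation_of_bounded_degree\<close> and \<open>motive_relation_of_bounded_degree\<close>).

  Two points turn this relation among twisted polynomials into one over \<open>L \<otimes> A\<close>.  First, the
  action of a polynomial in \<open>x\<close> and \<open>y\<close> must depend only on its class modulo the curve equation
  (\<open>motive_act_eq_0\<close>).  The equation has coefficients in the field with \<open>q\<close> elements, and \<open>\<tau>\<close>
  commutes with these; so a monomial times the equation acts as right multiplication with the image
  under \<open>\<phi>\<close> of an element that is zero in the coordinate ring.  Second, a nontrivial coefficient
  vector must give a nonzero \<open>C\<^sub>k\<close>; this holds because the monomials used have degree at most one in
  \<open>y\<close>, and the equation is monic of degree two in \<open>y\<close> (\<open>coord_class_monomial_sum_eq_zero_iff\<close>).\<close>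

section \<open>Linear relations between polynomials of bounded degree\<close>

text \<open>Gaussian elimination for vectors in the space of polynomials of degree below \<open>n\<close>, whose
  dimension is \<open>n\<close>.  The vectors form an indexed family, so that a repeated vector counts with its
  multiplicity.\<close>
lemma linear_relation_of_bounded_degree:
  fixes v :: "'i \<Rightarrow> 'a::field poly"
  assumes "finite I" and "card I > n" and "\<And>i k. i \<in> I \<Longrightarrow> k \<ge> n \<Longrightarrow> coeff (v i) k = 0"
  shows "\<exists>c. (\<exists>i\<in>I. c i \<noteq> 0) \<and> (\<Sum>i\<in>I. smult (c i) (v i)) = 0"
  using assms
proof (induction n arbitrary: I v)
  case 0
  then have "v i = 0" if "i \<in> I" for i
    using that by (intro poly_eqI) auto
  moreover obtain i where "i \<in> I"
    using 0 by fastforce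
  ultimately show ?case
    by (intro exI[of _ "\<lambda>_. 1"]) auto
next
  case (Suc n)
  show ?case
  proof (cases "\<forall>i\<in>I. coeff (v i) n = 0")
    case True
    have "coeff (v i) k = 0" if "i \<in> I" "k \<ge> n" for i k
      using that True Suc.prems(3)[of i k] by (cases "k = n") auto
    then show ?thesis
      using Suc.IH[of I v] Suc.prems by simp
  next
    case False
    then obtain p where p: "p \<in> I" "coeff (v p) n \<noteq> 0"
      by blast
    \<comment> \<open>subtracting multiples of the pivot \<open>v p\<close> clears the coefficients at \<open>n\<close>\<close>
    define r where "r i = coeff (v i) n / coeff (v p) n" for i
    define w where "w i = v i - smult (r i) (v p)" for i
    have "coeff (w i) k = 0" if "i \<in> I - {p}" "k \<ge> n" for i k
      using that p Suc.prems(3)[of i k] Suc.prems(3)[of p k]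
      by (cases "k = n") (auto simp: w_def r_def)
    moreover have "card (I - {p}) > n"
      using Suc.prems p by simp
    ultimately obtain c where c: "\<exists>i\<in>I - {p}. c i \<noteq> 0"
      "(\<Sum>i\<in>I - {p}. smult (c i) (w i)) = 0"
      using Suc.IH[of "I - {p}" w] Suc.prems(1) by auto
    \<comment> \<open>the coefficient at the pivot undoes the subtractions\<close>
    define d where "d = c(p := - (\<Sum>i\<in>I - {p}. c i * r i))"
    have "(\<Sum>i\<in>I. smult (d i) (v i)) = smult (d p) (v p) + (\<Sum>i\<in>I - {p}. smult (d i) (v i))"
      using Suc.prems(1) p(1) by (rule sum.remove)
    also have "(\<Sum>i\<in>I - {p}. smult (d i) (v i)) = (\<Sum>i\<in>I - {p}. smult (c i) (v i))"
      by (intro sum.cong) (auto simp: d_def)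
    also have "smult (d p) (v p) + \<dots> = (\<Sum>i\<in>I - {p}. smult (c i) (w i))"
      by (simp add: d_def w_def smult_diff_right sum_subtractf smult_sum)
    finally have "(\<Sum>i\<in>I. smult (d i) (v i)) = 0"
      using c(2) by simp
    moreover have "\<exists>i\<in>I. d i \<noteq> 0"
      using c(1) by (auto simp: d_def)
    ultimately show ?thesis
      by blast
  qed
qed

section \<open>The coordinate ring\<close>

lemma XY_ring_simps [simp]:
  "carrier XY_ring = UNIV" "P \<otimes>\<^bsub>XY_ring\<^esub> Q = P * Q" "P \<oplus>\<^bsub>XY_ring\<^esub> Q = P + Q"
  "\<one>\<^bsub>XY_ring\<^esub> = 1" "\<zero>\<^bsub>XY_ring\<^esub> = 0"
  by (simp_all add: ring_of_type_algebra_def)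

lemma mem_coord_class_iff: "Q \<in> coord_class E P \<longleftrightarrow> wpoly E dvd Q - P"
proof -
  have "Q \<in> coord_class E P \<longleftrightarrow> (\<exists>R. Q = R * wpoly E + P)"
    by (auto simp: coord_class_def a_r_coset_def' cgenideal_def)
  also have "\<dots> \<longleftrightarrow> wpoly E dvd Q - P"
    by (auto simp: dvd_def algebra_simps)
  finally show ?thesis .
qed

lemma coord_ideal: "ideal (PIdl\<^bsub>XY_ring\<^esub> (wpoly E)) XY_ring"
  by (intro cring.cgenideal_ideal cring_from_type_algebra) auto

lemma coord_ring_cring: "cring (coord_ring E)"
  unfolding coord_ring_def
  by (intro ideal.quotient_is_cring coord_ideal cring_from_type_algebra)

lemma coord_class_hom: "coord_class E \<in> ring_hom XY_ring (coord_ring E)"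
  unfolding coord_ring_def coord_class_def[abs_def] by (rule ideal.rcos_ring_hom[OF coord_ideal])

lemma coord_class_closed [simp]: "coord_class E P \<in> carrier (coord_ring E)"
  and coord_class_mult: "coord_class E (P * Q) = coord_class E P \<otimes>\<^bsub>coord_ring E\<^esub> coord_class E Q"
  and coord_class_add: "coord_class E (P + Q) = coord_class E P \<oplus>\<^bsub>coord_ring E\<^esub> coord_class E Q"
  and coord_class_one: "coord_class E 1 = \<one>\<^bsub>coord_ring E\<^esub>"
  using ring_hom_closed[OF coord_class_hom] ring_hom_mult[OF coord_class_hom]
    ring_hom_add[OF coord_class_hom] ring_hom_one[OF coord_class_hom]
  by simp_all

lemma coord_class_zero: "coord_class E 0 = \<zero>\<^bsub>coord_ring E\<^esub>"
  using ring_hom_zero[OF coord_class_hom ring_from_type_algebra cring.axioms(1)[OF coord_ring_cring]]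
  by simp

lemma coord_class_power: "coord_class E (P ^ n) = coord_class E P [^]\<^bsub>coord_ring E\<^esub> n"
proof -
  interpret cring "coord_ring E" by (rule coord_ring_cring)
  show ?thesis
    by (induction n) (simp_all add: coord_class_one coord_class_mult power_Suc2 del: power_Suc)
qed

lemma coord_class_eqI:
  assumes "wpoly E dvd P - Q"
  shows "coord_class E P = coord_class E Q"
proof -
  have "wpoly E dvd R - P \<longleftrightarrow> wpoly E dvd R - Q" for R
    using dvd_add_right_iff[OF assms, of "R - P"] by simp
  then show ?thesis
    by (auto simp: set_eq_iff mem_coord_class_iff)
qed

text \<open>The equation of the curve is monic of degree two in \<open>Y\<close>, so \<open>1\<close> and \<open>y\<close> are linearly independent
  over the polynomials in \<open>x\<close>.\<close>
lemma coord_class_eq_zero_iff: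
  fixes E :: "'a::idom weierstrass"
  assumes "degree P < 2"
  shows "coord_class E P = \<zero>\<^bsub>coord_ring E\<^esub> \<longleftrightarrow> P = 0"
proof
  assume "coord_class E P = \<zero>\<^bsub>coord_ring E\<^esub>"
  then have "P \<in> coord_class E 0"
    using mem_coord_class_iff[of P E P] by (simp add: coord_class_zero)
  then have dvd: "wpoly E dvd P"
    by (simp add: mem_coord_class_iff)
  have "degree (wpoly E) = 2"
    by (simp add: wpoly_def)
  then show "P = 0"
    using dvd_imp_degree_le[OF dvd] assms by auto
qed (simp add: coord_class_zero)

text \<open>The monomial \<open>X\<^sup>j Y\<^sup>i\<close>, with the exponent of the inner variable \<open>X\<close> first.\<close>
definition bimonom :: "nat \<Rightarrow> nat \<Rightarrow> 'a::comm_ring_1 poly poly" where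
  "bimonom j i = monom (monom 1 j) i"

lemma bimonom_eq_mult: "bimonom j i = [:[:0, 1:]:] ^ j * [:0, 1:] ^ i"
  by (simp add: bimonom_def monom_altdef poly_const_pow)

lemma coord_class_bimonom:
  "coord_class E (bimonom j i) =
     coord_x E [^]\<^bsub>coord_ring E\<^esub> j \<otimes>\<^bsub>coord_ring E\<^esub> coord_y E [^]\<^bsub>coord_ring E\<^esub> i"
  by (simp add: bimonom_eq_mult coord_class_mult coord_class_power coord_x_def coord_y_def)

lemma bipoly_eq_sum_bimonom:
  "P = (\<Sum>i\<le>degree P. \<Sum>j\<le>degree (coeff P i). smult [:coeff (coeff P i) j:] (bimonom j i))"
proof -
  have "smult [:c:] (bimonom j i) = monom (monom c j) i" for c :: 'a and i j
    by (simp add: bimonom_def smult_monom)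
  then show ?thesis
    by (simp add: poly_as_sum_of_monoms flip: monom_sum)
qed

lemma coord_class_combination_in_Span:
  "coord_class E (\<Sum>m\<leftarrow>ms. smult [:c m:] (f m)) \<in>
     ring.Span (coord_ring E) (range (coord_const E)) (map (\<lambda>m. coord_class E (f m)) ms)"
proof (induction ms)
  case Nil
  interpret cring "coord_ring E" by (rule coord_ring_cring)
  show ?case by (simp add: coord_class_zero)
next
  case (Cons m ms)
  interpret cring "coord_ring E" by (rule coord_ring_cring)
  have "coord_class E (smult [:c m:] (f m)) = coord_const E (c m) \<otimes>\<^bsub>coord_ring E\<^esub> coord_class E (f m)"
    by (simp add: coord_const_def flip: coord_class_mult)
  then show ?case
    using Cons by (auto simp: line_extension_mem_iff coord_class_add)
qed

definition monomial_sum :: "(nat \<times> nat \<Rightarrow> 'a::comm_ring_1) \<Rightarrow> (nat \<times> nat) list \<Rightarrow> 'a poly poly" where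
  "monomial_sum c ms = (\<Sum>m\<leftarrow>ms. smult [:c m:] (bimonom (fst m) (snd m)))"

lemma coeff_monomial_sum:
  "distinct ms \<Longrightarrow>
     coeff (coeff (monomial_sum c ms) i) j = (if (j, i) \<in> set ms then c (j, i) else 0)"
proof (induction ms)
  case (Cons m ms)
  have "coeff (coeff (smult [:c m:] (bimonom (fst m) (snd m))) i) j = (if m = (j, i) then c m else 0)"
    by (cases m) (auto simp: bimonom_def)
  then show ?case
    using Cons by (auto simp: monomial_sum_def)
qed (simp add: monomial_sum_def)

lemma degree_monomial_sum_less:
  assumes "n > 0" and "\<And>j i. (j, i) \<in> set ms \<Longrightarrow> i < n"
  shows "degree (monomial_sum c ms) < n"
  using assms(2)
proof (induction ms)
  case (Cons m ms)
  have "degree (smult [:c m:] (bimonom (fst m) (snd m))) < n"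
    using Cons.prems[of "fst m" "snd m"]
    by (auto simp: bimonom_def intro!: le_less_trans[OF degree_smult_le] le_less_trans[OF degree_monom_le])
  then show ?case
    using Cons by (auto simp: monomial_sum_def intro!: degree_add_less)
qed (simp add: monomial_sum_def assms(1))

lemma coord_class_monomial_sum_eq_zero_iff:
  fixes E :: "'a::idom weierstrass"
  assumes "distinct ms" and "\<And>j i. (j, i) \<in> set ms \<Longrightarrow> i < 2"
  shows "coord_class E (monomial_sum c ms) = \<zero>\<^bsub>coord_ring E\<^esub> \<longleftrightarrow> (\<forall>m\<in>set ms. c m = 0)"
proof -
  have "coord_class E (monomial_sum c ms) = \<zero>\<^bsub>coord_ring E\<^esub> \<longleftrightarrow> monomial_sum c ms = 0"
    using assms(2) by (intro coord_class_eq_zero_iff degree_monomial_sum_less) simp_all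
  also have "\<dots> \<longleftrightarrow> (\<forall>m\<in>set ms. c m = 0)"
    by (auto simp: poly_eq_iff coeff_monomial_sum assms(1))
  finally show ?thesis .
qed

section \<open>Twisted multiplication\<close>

lemma smult_sum2: "smult c (\<Sum>a\<in>A. f a) = (\<Sum>a\<in>A. smult c (f a))"
  by (induction A rule: infinite_finite_induct) (simp_all add: smult_add_right)

text \<open>Common summation bounds make sums of products comparable.  Raising the bound on \<open>g\<close> is
  harmless only because \<open>0\<close> to the power \<open>q\<^sup>i\<close> is \<open>0\<close>, which is where \<open>q > 0\<close> enters.\<close>
lemma twisted_mult_eq_sum:
  assumes q: "q > 0" and m: "degree f \<le> m" and n: "degree g \<le> n"
  shows "twisted_mult q f g = (\<Sum>i\<le>m. \<Sum>j\<le>n. monom (coeff f i * coeff g j ^ (q ^ i)) (i + j))"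
proof -
  have "(\<Sum>j\<le>degree g. monom (coeff f i * coeff g j ^ (q ^ i)) (i + j)) =
      (\<Sum>j\<le>n. monom (coeff f i * coeff g j ^ (q ^ i)) (i + j))" for i
    using n q by (intro sum.mono_neutral_left) (auto simp: coeff_eq_0 power_0_left)
  then have "twisted_mult q f g =
      (\<Sum>i\<le>degree f. \<Sum>j\<le>n. monom (coeff f i * coeff g j ^ (q ^ i)) (i + j))"
    by (simp add: twisted_mult_def)
  also have "\<dots> = (\<Sum>i\<le>m. \<Sum>j\<le>n. monom (coeff f i * coeff g j ^ (q ^ i)) (i + j))"
    using m by (intro sum.mono_neutral_left) (auto simp: coeff_eq_0)
  finally show ?thesis .
qed

lemma degree_twisted_mult_le: "degree (twisted_mult q f g) \<le> degree f + degree g"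
  unfolding twisted_mult_def
  by (intro degree_sum_le finite_atMost) (auto intro: order_trans[OF degree_monom_le])

lemma twisted_mult_const_left: "twisted_mult q [:c:] g = smult c g"
proof -
  have "twisted_mult q [:c:] g = smult c (\<Sum>j\<le>degree g. monom (coeff g j) j)"
    by (simp add: twisted_mult_def smult_sum2 smult_monom)
  then show ?thesis
    by (simp add: poly_as_sum_of_monoms)
qed

lemma twisted_mult_smult_left:
  "q > 0 \<Longrightarrow> twisted_mult q (smult c f) g = smult c (twisted_mult q f g)"
  by (simp add: twisted_mult_eq_sum[of q _ "degree f" g "degree g"] degree_smult_le smult_sum2
      smult_monom mult.assoc)

lemma power_iterate_add:
  assumes "\<And>x y :: 'a::comm_ring_1. (x + y) ^ q = x ^ q + y ^ q"
  shows "(x + y :: 'a) ^ (q ^ n) = x ^ (q ^ n) + y ^ (q ^ n)"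
  by (induction n arbitrary: x y) (simp_all add: power_mult assms)

lemma twisted_mult_add_right:
  fixes f g h :: "'a::field poly"
  assumes q: "q > 0" and frob: "\<And>x y :: 'a. (x + y) ^ q = x ^ q + y ^ q"
  shows "twisted_mult q f (g + h) = twisted_mult q f g + twisted_mult q f h"
proof -
  define n where "n = max (degree g) (degree h)"
  have n: "degree g \<le> n" "degree h \<le> n" "degree (g + h) \<le> n"
    by (simp_all add: n_def degree_add_le_max)
  show ?thesis
    by (simp add: twisted_mult_eq_sum[OF q order_refl n(1)] twisted_mult_eq_sum[OF q order_refl n(2)]
        twisted_mult_eq_sum[OF q order_refl n(3)] power_iterate_add[OF frob] algebra_simps
        flip: sum.distrib add_monom)
qed

text \<open>Scalars fixed by the \<open>q\<close>-th power map commute with \<open>\<tau>\<close>.\<close>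
lemma twisted_mult_smult_right:
  assumes q: "q > 0" and c: "c ^ q = c"
  shows "twisted_mult q f (smult c g) = smult c (twisted_mult q f g)"
proof -
  have "c ^ (q ^ i) = c" for i
    by (induction i) (simp_all add: power_mult c)
  then show ?thesis
    by (simp add: twisted_mult_eq_sum[OF q order_refl degree_smult_le] smult_sum2
        twisted_mult_eq_sum[OF q order_refl order_refl] smult_monom power_mult_distrib mult_ac)
qed

lemma twisted_poly_ring_simps [simp]:
  "carrier (twisted_poly_ring q) = UNIV" "f \<otimes>\<^bsub>twisted_poly_ring q\<^esub> g = twisted_mult q f g"
  "f \<oplus>\<^bsub>twisted_poly_ring q\<^esub> g = f + g" "\<one>\<^bsub>twisted_poly_ring q\<^esub> = 1"
  by (simp_all add: twisted_poly_ring_def)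

lemma degree_twisted_power_le: "degree (f [^]\<^bsub>twisted_poly_ring q\<^esub> (n::nat)) \<le> n * degree f"
proof (induction n)
  case (Suc n)
  then show ?case
    using degree_twisted_mult_le[of q "f [^]\<^bsub>twisted_poly_ring q\<^esub> n" f]
    by (simp add: nat_pow_def)
qed (simp add: nat_pow_def)

section \<open>The action on the Anderson motive\<close>

text \<open>The polynomial \<open>(X + 1)\<^sup>q - X\<^sup>q - 1\<close> has degree below \<open>q\<close>, yet it vanishes at all \<open>q\<close> elements of
  the field, because \<open>x\<^sup>q = x\<close> for each of them.  Hence its coefficients vanish.  This gives the
  additivity of \<open>x \<mapsto> x\<^sup>q\<close> in every extension without writing \<open>q\<close> as a power of the characteristic.\<close>
lemma binomial_card_eq_0:
  assumes "0 < k" and "k < CARD('k::finite_field)"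
  shows "of_nat (CARD('k) choose k) = (0::'k)"
proof -
  define q where "q = CARD('k)"
  define P :: "'k poly" where "P = (\<Sum>k\<in>{0<..<q}. monom (of_nat (q choose k)) k)"
  have coeff: "coeff P k = (if 0 < k \<and> k < q then of_nat (q choose k) else 0)" for k
    by (simp add: P_def coeff_sum)
  have q: "q > 0"
    by (simp add: q_def)
  have "poly P x = 0" for x
  proof -
    have "x + 1 = (x + 1) ^ q"
      by (simp add: q_def finite_field_power_card_eq_same)
    also have "\<dots> = (\<Sum>k\<le>q. of_nat (q choose k) * x ^ k)"
      by (simp add: binomial_ring)
    also have "{..q} = insert 0 (insert q {0<..<q})"
      using q by auto
    also have "(\<Sum>k\<in>\<dots>. of_nat (q choose k) * x ^ k) = 1 + (x ^ q + poly P x)"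
      using q by (simp add: P_def poly_sum poly_monom)
    also have "x ^ q = x"
      by (simp add: q_def finite_field_power_card_eq_same)
    finally show ?thesis
      by simp
  qed
  then have roots: "{x. poly P x = 0} = UNIV"
    by auto
  have "P = 0"
  proof (rule ccontr)
    assume "P \<noteq> 0"
    then have "q \<le> degree P"
      using card_poly_roots_bound[of P] roots by (simp add: q_def)
    moreover have "degree P < q"
      using degree_le[of "q - 1" P] coeff q by fastforce
    ultimately show False
      by simp
  qed
  then show ?thesis
    using coeff[of k] assms by (simp add: q_def)
qed

text \<open>This is what makes the action on the motive well defined: \<open>\<phi>\<close> is a homomorphism of algebras over
  the field with \<open>q\<close> elements, which \<open>\<iota>\<close> includes in \<open>L\<close>.\<close>
locale twisted_hom =
  fixes E :: "'k::finite_field weierstrass"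
    and \<iota> :: "'k poly poly set \<Rightarrow> 'l::field"
    and \<phi> :: "'k poly poly set \<Rightarrow> 'l poly"
    and q :: nat
  assumes q: "q = CARD('k)"
    and \<iota>_hom: "\<iota> \<in> ring_hom (coord_ring E) ring_of_type_algebra"
    and \<phi>_hom: "twisted_algebra_hom E \<iota> \<phi>"
begin

lemma q_pos [simp]: "q > 0" "q \<noteq> 0"
  by (simp_all add: q)

text \<open>The inclusion of the ground field in \<open>L\<close>.\<close>
definition \<kappa> :: "'k \<Rightarrow> 'l" where "\<kappa> c = \<iota> (coord_const E c)"

lemma \<kappa>_add: "\<kappa> (c + d) = \<kappa> c + \<kappa> d"
  using ring_hom_add[OF \<iota>_hom, of "coord_const E c" "coord_const E d"]
  by (simp add: \<kappa>_def coord_const_def ring_of_type_algebra_def flip: coord_class_add)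

lemma \<kappa>_mult: "\<kappa> (c * d) = \<kappa> c * \<kappa> d"
  using ring_hom_mult[OF \<iota>_hom, of "coord_const E c" "coord_const E d"]
  by (simp add: \<kappa>_def coord_const_def ring_of_type_algebra_def mult.commute flip: coord_class_mult)

lemma \<kappa>_1 [simp]: "\<kappa> 1 = 1"
  using ring_hom_one[OF \<iota>_hom] coord_class_one[of E]
  by (simp add: \<kappa>_def coord_const_def ring_of_type_algebra_def one_pCons)

lemma \<kappa>_0 [simp]: "\<kappa> 0 = 0"
  using \<kappa>_add[of 0 0] by (simp only: add_0 add_cancel_right_right)

lemma \<kappa>_minus: "\<kappa> (- c) = - \<kappa> c"
  using \<kappa>_add[of c "- c"] by (simp add: eq_neg_iff_add_eq_0 add.commute)

lemma \<kappa>_eq_0_iff [simp]: "\<kappa> c = 0 \<longleftrightarrow> c = 0"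
  using \<kappa>_mult[of c "inverse c"] by (cases "c = 0") auto

lemma \<kappa>_power: "\<kappa> (c ^ n) = \<kappa> c ^ n"
  by (induction n) (simp_all add: \<kappa>_mult)

lemma \<kappa>_of_nat: "\<kappa> (of_nat n) = of_nat n"
  by (induction n) (simp_all add: \<kappa>_add)

lemma \<kappa>_frobenius: "\<kappa> c ^ q = \<kappa> c"
  by (simp add: q finite_field_power_card_eq_same flip: \<kappa>_power)

text \<open>The middle binomial coefficients vanish in the ground field, hence also in \<open>L\<close>.\<close>
lemma frobenius_add: "(x + y) ^ q = x ^ q + (y :: 'l) ^ q"
proof -
  have "(x + y) ^ q = (\<Sum>k\<le>q. of_nat (q choose k) * x ^ k * y ^ (q - k))"
    by (rule binomial_ring)
  also have "\<dots> = (\<Sum>k\<in>{0, q}. of_nat (q choose k) * x ^ k * y ^ (q - k))"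
  proof (intro sum.mono_neutral_right ballI)
    fix k assume "k \<in> {..q} - {0, q}"
    then have "\<kappa> (of_nat (q choose k)) = \<kappa> 0"
      unfolding q by (subst binomial_card_eq_0) auto
    then show "of_nat (q choose k) * x ^ k * y ^ (q - k) = 0"
      by (simp add: \<kappa>_of_nat)
  qed auto
  finally show ?thesis
    using q_pos by (simp add: add.commute)
qed

lemma \<phi>_add: "\<phi> (coord_class E (P + Q)) = \<phi> (coord_class E P) + \<phi> (coord_class E Q)"
  and \<phi>_mult: "\<phi> (coord_class E (P * Q)) =
    twisted_mult q (\<phi> (coord_class E P)) (\<phi> (coord_class E Q))"
  and \<phi>_1: "\<phi> (coord_class E 1) = 1"
  and \<phi>_const: "\<phi> (coord_class E [:[:c:]:]) = [:\<kappa> c:]"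
proof -
  have hom: "\<phi> \<in> ring_hom (coord_ring E) (twisted_poly_ring q)"
    using \<phi>_hom by (simp add: twisted_algebra_hom_def q)
  show "\<phi> (coord_class E (P + Q)) = \<phi> (coord_class E P) + \<phi> (coord_class E Q)"
    using ring_hom_add[OF hom, of "coord_class E P" "coord_class E Q"] by (simp add: coord_class_add)
  show "\<phi> (coord_class E (P * Q)) =
      twisted_mult q (\<phi> (coord_class E P)) (\<phi> (coord_class E Q))"
    using ring_hom_mult[OF hom, of "coord_class E P" "coord_class E Q"] by (simp add: coord_class_mult)
  show "\<phi> (coord_class E 1) = 1"
    using ring_hom_one[OF hom] by (simp add: coord_class_one)
  show "\<phi> (coord_class E [:[:c:]:]) = [:\<kappa> c:]"
    using \<phi>_hom by (simp add: twisted_algebra_hom_def \<kappa>_def coord_const_def)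
qed

abbreviation monomial_action :: "nat \<Rightarrow> nat \<Rightarrow> 'l poly \<Rightarrow> 'l poly" where
  "monomial_action j i \<omega> \<equiv> twisted_mult q \<omega> (\<phi> (coord_class E (bimonom j i)))"

lemma motive_act_eq_sum:
  "motive_act E \<phi> P \<omega> =
     (\<Sum>i\<le>degree P. \<Sum>j\<le>degree (coeff P i). smult (coeff (coeff P i) j) (monomial_action j i \<omega>))"
  by (simp add: motive_act_def q[symmetric] twisted_mult_const_left twisted_mult_smult_left flip: coord_class_bimonom)

lemma motive_act_eq_sum_bounded:
  assumes "degree P \<le> m" and "\<And>i. degree (coeff P i) \<le> n"
  shows "motive_act E \<phi> P \<omega> = (\<Sum>i\<le>m. \<Sum>j\<le>n. smult (coeff (coeff P i) j) (monomial_action j i \<omega>))"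
proof -
  have "(\<Sum>j\<le>degree (coeff P i). smult (coeff (coeff P i) j) (monomial_action j i \<omega>)) =
      (\<Sum>j\<le>n. smult (coeff (coeff P i) j) (monomial_action j i \<omega>))" for i
    using assms(2)[of i] by (intro sum.mono_neutral_left) (auto simp: coeff_eq_0)
  then have "motive_act E \<phi> P \<omega> =
      (\<Sum>i\<le>degree P. \<Sum>j\<le>n. smult (coeff (coeff P i) j) (monomial_action j i \<omega>))"
    by (simp add: motive_act_eq_sum)
  also have "\<dots> = (\<Sum>i\<le>m. \<Sum>j\<le>n. smult (coeff (coeff P i) j) (monomial_action j i \<omega>))"
    using assms(1) by (intro sum.mono_neutral_left) (auto simp: coeff_eq_0)
  finally show ?thesis .
qed

lemma bounded_bidegree:
  fixes P :: "'a::zero poly poly"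
  obtains n where "\<And>i. degree (coeff P i) \<le> n"
proof
  show "degree (coeff P i) \<le> Max ((\<lambda>i. degree (coeff P i)) ` {..Suc (degree P)})" for i
  proof (cases "i \<le> degree P")
    case True
    then show ?thesis by (intro Max_ge) auto
  next
    case False
    then show ?thesis by (simp add: coeff_eq_0)
  qed
qed

lemma motive_act_add: "motive_act E \<phi> (P + Q) \<omega> = motive_act E \<phi> P \<omega> + motive_act E \<phi> Q \<omega>"
proof -
  obtain nP nQ where n: "\<And>i. degree (coeff P i) \<le> nP" "\<And>i. degree (coeff Q i) \<le> nQ"
    by (metis bounded_bidegree)
  define m n where "m = max (degree P) (degree Q)" and "n = max nP nQ"
  have m: "degree P \<le> m" "degree Q \<le> m" "degree (P + Q) \<le> m"
    by (simp_all add: m_def degree_add_le_max)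
  have P: "degree (coeff P i) \<le> n" and Q: "degree (coeff Q i) \<le> n"
    and PQ: "degree (coeff (P + Q) i) \<le> n" for i
    using n[of i] by (auto simp: n_def intro!: degree_add_le)
  show ?thesis
    by (simp add: motive_act_eq_sum_bounded[OF m(1) P] motive_act_eq_sum_bounded[OF m(2) Q]
        motive_act_eq_sum_bounded[OF m(3) PQ] smult_add_left sum.distrib)
qed

lemma motive_act_smult: "motive_act E \<phi> (smult [:c:] P) \<omega> = smult c (motive_act E \<phi> P \<omega>)"
proof -
  obtain n where n: "\<And>i. degree (coeff P i) \<le> n"
    by (metis bounded_bidegree)
  have cn: "degree (coeff (smult [:c:] P) i) \<le> n" for i
    using n[of i] by (auto intro: order_trans[OF degree_smult_le])
  show ?thesis
    by (simp add: motive_act_eq_sum_bounded[OF degree_smult_le cn] smult_sum2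
        motive_act_eq_sum_bounded[OF order_refl n])
qed

lemma motive_act_0 [simp]: "motive_act E \<phi> 0 \<omega> = 0"
  by (simp add: motive_act_eq_sum)

lemma motive_act_sum: "motive_act E \<phi> (\<Sum>a\<in>A. P a) \<omega> = (\<Sum>a\<in>A. motive_act E \<phi> (P a) \<omega>)"
  by (induction A rule: infinite_finite_induct) (simp_all add: motive_act_add)

lemma motive_act_sum_list:
  "motive_act E \<phi> (\<Sum>m\<leftarrow>ms. P m) \<omega> = (\<Sum>m\<leftarrow>ms. motive_act E \<phi> (P m) \<omega>)"
  by (induction ms) (simp_all add: motive_act_add)

lemma motive_act_bimonom: "motive_act E \<phi> (bimonom j i) \<omega> = monomial_action j i \<omega>"
proof -
  have "motive_act E \<phi> (bimonom j i) \<omega> =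
      (\<Sum>i'\<le>i. \<Sum>j'\<le>j. smult (coeff (coeff (bimonom j i) i') j') (monomial_action j' i' \<omega>))"
    by (rule motive_act_eq_sum_bounded) (auto simp: bimonom_def degree_monom_le intro!: degree_monom_le)
  also have "\<dots> = (\<Sum>i'\<le>i. \<Sum>j'\<le>j. if j' = j then if i' = i then monomial_action j i \<omega> else 0 else 0)"
    by (intro sum.cong refl) (auto simp: bimonom_def)
  finally show ?thesis
    by simp
qed

abbreviation extend_scalars :: "'k poly poly \<Rightarrow> 'l poly poly" where
  "extend_scalars \<equiv> map_poly (map_poly \<kappa>)"

text \<open>A polynomial over the ground field acts by right multiplication with the image of its class:
  \<open>\<omega> \<mapsto> \<omega> \<phi>\<^sub>a\<close> is additive in \<open>a\<close> by the additivity of the Frobenius, and constants of the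
  ground field can be moved to the left of \<open>\<omega>\<close> because the Frobenius fixes them.\<close>
lemma motive_act_extend_scalars:
  "motive_act E \<phi> (extend_scalars P) \<omega> = twisted_mult q \<omega> (\<phi> (coord_class E P))"
proof -
  define F where "F P = twisted_mult q \<omega> (\<phi> (coord_class E P))" for P
  have F_add: "F (P + Q) = F P + F Q" for P Q
    by (simp add: F_def \<phi>_add twisted_mult_add_right frobenius_add)
  have F_0: "F 0 = 0"
    using F_add[of 0 0] by (simp only: add_0 add_cancel_right_right)
  have F_sum: "F (\<Sum>a\<in>A. P a) = (\<Sum>a\<in>A. F (P a))" for A :: "nat set" and P
    by (induction A rule: infinite_finite_induct) (simp_all add: F_add F_0)
  have F_smult: "F (smult [:c:] P) = smult (\<kappa> c) (F P)" for c P
  proof -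
    have "F (smult [:c:] P) = F ([:[:c:]:] * P)"
      by simp
    then show ?thesis
      by (simp only: F_def \<phi>_mult \<phi>_const twisted_mult_const_left)
        (simp add: twisted_mult_smult_right \<kappa>_frobenius)
  qed
  have "F P = F (\<Sum>i\<le>degree P. \<Sum>j\<le>degree (coeff P i). smult [:coeff (coeff P i) j:] (bimonom j i))"
    using bipoly_eq_sum_bimonom[of P] by simp
  also have "\<dots> = (\<Sum>i\<le>degree P. \<Sum>j\<le>degree (coeff P i). smult (\<kappa> (coeff (coeff P i) j)) (F (bimonom j i)))"
    by (simp add: F_sum F_smult)
  also have "\<dots> = motive_act E \<phi> (extend_scalars P) \<omega>"
    by (simp add: motive_act_eq_sum F_def coeff_map_poly degree_map_poly map_poly_eq_0_iff)
  finally show ?thesis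
    by (simp add: F_def)
qed

lemma wpoly_base_change: "wpoly (base_change E \<iota>) = extend_scalars (wpoly E)"
  by (simp add: wpoly_def base_change_def weierstrass.map_sel map_poly_pCons one_pCons \<kappa>_minus
      flip: \<kappa>_def)

lemma extend_scalars_mult_bimonom:
  "extend_scalars (P * bimonom j i) = extend_scalars P * bimonom j i"
  by (intro poly_eqI)
    (simp add: coeff_map_poly bimonom_def mult.commute[of _ "monom _ _"] coeff_monom_mult
      if_distrib[of "map_poly \<kappa>"] if_distrib[of \<kappa>])

text \<open>By \<open>L\<close>-linearity it is enough to consider the products of the curve equation with a monomial.
  These have coefficients in the ground field, so they act through their class, which is zero.\<close>
lemma motive_act_eq_0:
  assumes "wpoly (base_change E \<iota>) dvd P"
  shows "motive_act E \<phi> P \<omega> = 0"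
proof -
  define W where "W = wpoly E"
  obtain Q where Q: "P = extend_scalars W * Q"
    using assms by (auto simp: wpoly_base_change W_def)
  have *: "motive_act E \<phi> (extend_scalars W * bimonom j i) \<omega> = 0" for i j
  proof -
    have "coord_class E (W * bimonom j i) = coord_class E 0"
      by (rule coord_class_eqI) (simp add: W_def)
    moreover have "\<phi> (coord_class E 0) = 0"
      using \<phi>_add[of 0 0] by (simp only: add_0 add_cancel_right_right)
    ultimately show ?thesis
      by (simp add: motive_act_extend_scalars twisted_mult_def power_0_left flip: extend_scalars_mult_bimonom)
  qed
  have "P = extend_scalars W *
      (\<Sum>i\<le>degree Q. \<Sum>j\<le>degree (coeff Q i). smult [:coeff (coeff Q i) j:] (bimonom j i))"
    unfolding Q by (rule arg_cong[OF bipoly_eq_sum_bimonom])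
  then have "P = (\<Sum>i\<le>degree Q. \<Sum>j\<le>degree (coeff Q i).
      smult [:coeff (coeff Q i) j:] (extend_scalars W * bimonom j i))"
    by (simp only: sum_distrib_left mult_smult_right)
  then show ?thesis
    by (simp only: motive_act_sum motive_act_smult * smult_0_right sum.neutral_const)
qed

text \<open>The action of a class can be computed from any representative, so the value that the motive
  selects with \<open>the_elem\<close> is the action of \<open>P\<close>.\<close>
lemma anderson_motive_smult:
  "coord_class (base_change E \<iota>) P \<odot>\<^bsub>anderson_motive E \<phi>\<^esub> \<omega> = motive_act E \<phi> P \<omega>"
proof -
  have "motive_act E \<phi> R \<omega> = motive_act E \<phi> P \<omega>" if "R \<in> coord_class (base_change E \<iota>) P" for R
    using motive_act_add[of "R - P" P \<omega>] motive_act_eq_0[of "R - P" \<omega>] that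
    by (simp add: mem_coord_class_iff)
  moreover have "P \<in> coord_class (base_change E \<iota>) P"
    by (simp add: mem_coord_class_iff)
  ultimately have "(\<lambda>P. motive_act E \<phi> P \<omega>) ` coord_class (base_change E \<iota>) P = {motive_act E \<phi> P \<omega>}"
    by blast
  then show ?thesis
    by (simp add: anderson_motive_def)
qed

lemma degree_monomial_action_le:
  "degree (monomial_action j i \<omega>) \<le>
     degree \<omega> + j * degree (\<phi> (coord_x E)) + i * degree (\<phi> (coord_y E))"
proof -
  have pow: "degree (\<phi> (coord_class E (P ^ n))) \<le> n * degree (\<phi> (coord_class E P))" for P n
  proof (induction n)
    case (Suc n)
    then show ?case
      using degree_twisted_mult_le[of q "\<phi> (coord_class E P)" "\<phi> (coord_class E (P ^ n))"]
      by (simp add: \<phi>_mult)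
  qed (simp add: \<phi>_1)
  have "degree (monomial_action j i \<omega>) \<le> degree \<omega> + degree (\<phi> (coord_class E (bimonom j i)))"
    by (rule degree_twisted_mult_le)
  also have "degree (\<phi> (coord_class E (bimonom j i))) \<le>
      degree (\<phi> (coord_class E ([:[:0, 1:]:] ^ j))) + degree (\<phi> (coord_class E ([:0, 1:] ^ i)))"
    by (simp only: bimonom_eq_mult \<phi>_mult degree_twisted_mult_le)
  also have "\<dots> \<le> j * degree (\<phi> (coord_x E)) + i * degree (\<phi> (coord_y E))"
    unfolding coord_x_def coord_y_def by (intro add_mono pow)
  finally show ?thesis
    by simp
qed

end

section \<open>The relation in the motive\<close>

context twisted_hom
begin

lemma motive_act_monomial_sum:
  "motive_act E \<phi> (monomial_sum c ms) \<omega> =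
     (\<Sum>m\<leftarrow>ms. smult (c m) (monomial_action (fst m) (snd m) \<omega>))"
  by (simp add: monomial_sum_def motive_act_sum_list motive_act_smult motive_act_bimonom)

lemma motive_act_monomial_sum_minus:
  "motive_act E \<phi> (monomial_sum (\<lambda>m. - c m) ms) \<omega> = - motive_act E \<phi> (monomial_sum c ms) \<omega>"
  by (induction ms) (simp_all add: motive_act_monomial_sum)

text \<open>The dimension count in the motive, for the vectors \<open>x\<^sup>j y\<^sup>i \<omega>\<^sub>k\<close>: their degrees are bounded because
  degrees in \<open>\<tau>\<close> are subadditive under the twisted product.\<close>
lemma motive_relation_of_bounded_degree:
  fixes r :: nat
  assumes distinct: "\<And>k. k < r \<Longrightarrow> distinct (ms k)"
    and degree: "\<And>k j i. k < r \<Longrightarrow> (j, i) \<in> set (ms k) \<Longrightarrow>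
      degree (\<omega> k) + j * degree (\<phi> (coord_x E)) + i * degree (\<phi> (coord_y E)) < n"
    and many: "(\<Sum>k<r. length (ms k)) > n"
  shows "\<exists>c. (\<exists>k<r. \<exists>m\<in>set (ms k). c k m \<noteq> 0) \<and>
    (\<Sum>k<r. motive_act E \<phi> (monomial_sum (c k) (ms k)) (\<omega> k)) = 0"
proof -
  define I where "I = Sigma {..<r} (\<lambda>k. set (ms k))"
  define v where "v = (\<lambda>(k, m). monomial_action (fst m) (snd m) (\<omega> k))"
  have "card I = (\<Sum>k<r. length (ms k))"
    unfolding I_def by (subst card_SigmaI) (auto simp: distinct_card distinct)
  then have "card I > n"
    using many by simp
  moreover have "coeff (v a) d = 0" if "a \<in> I" and "d \<ge> n" for a d
  proof -
    obtain k j i where a: "a = (k, j, i)"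
      by (metis prod.exhaust)
    have "degree (v a) < n"
      using that(1) unfolding a v_def I_def
      by (auto intro!: le_less_trans[OF degree_monomial_action_le] degree)
    then show ?thesis
      using that(2) by (simp add: coeff_eq_0)
  qed
  ultimately obtain c where c: "\<exists>a\<in>I. c a \<noteq> 0" "(\<Sum>a\<in>I. smult (c a) (v a)) = 0"
    using linear_relation_of_bounded_degree[of I n v] by (auto simp: I_def)
  have "(\<Sum>k<r. motive_act E \<phi> (monomial_sum (\<lambda>m. c (k, m)) (ms k)) (\<omega> k)) =
      (\<Sum>k<r. \<Sum>m\<in>set (ms k). smult (c (k, m)) (v (k, m)))"
    using distinct
    by (intro sum.cong) (simp_all add: motive_act_monomial_sum v_def sum_list_distinct_conv_sum_set)
  also have "\<dots> = (\<Sum>a\<in>I. smult (c a) (v a))"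
    by (simp add: I_def sum.Sigma case_prod_unfold)
  finally show ?thesis
    using c by (intro exI[of _ "\<lambda>k m. c (k, m)"]) (auto simp: I_def)
qed

end

theorem proposition3p1:
  fixes E :: "'k::finite_field weierstrass"
    and \<iota> :: "'k poly poly set \<Rightarrow> 'l::alg_closed_field"
    and \<theta> \<eta> g1 g2 g3 h1 h2 h3 h4 h5 P0 P3 :: 'l
    and \<phi> :: "'k poly poly set \<Rightarrow> 'l poly"
    and q :: nat
  assumes q: "q = CARD('k)"
    and elliptic: "is_elliptic E"
    and \<iota>_hom: "\<iota> \<in> ring_hom (coord_ring E) ring_of_type_algebra"
    and \<iota>_inj: "inj_on \<iota> (carrier (coord_ring E))"
    and \<theta>: "\<theta> = \<iota> (coord_x E)"
    and \<eta>: "\<eta> = \<iota> (coord_y E)"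
    and \<phi>_hom: "twisted_algebra_hom E \<iota> \<phi>"
    and \<phi>_x: "\<phi> (coord_x E) = [:\<theta>, g1, g2, g3, 1:]"
    and \<phi>_y: "\<phi> (coord_y E) = [:\<eta>, h1, h2, h3, h4, h5, 1:]"
    and P0: "P0 = h4 - g2 ^ (q ^ 2) - (h5 - g3 ^ (q ^ 2)) * g3 ^ q"
    and P3: "P3 = h3 - g1 ^ (q ^ 2) - (h5 - g3 ^ (q ^ 2)) * g2 ^ q - P0 * g3"
    and P3_nz: "P3 \<noteq> 0"
  shows
    "let T = twisted_poly_ring q;
         M = anderson_motive E \<phi>;
         s = motive_gen;
         A = coord_ring_L E \<iota>;
         x = coord_x (base_change E \<iota>);
         y = coord_y (base_change E \<iota>)
     in \<exists>C0 C1 C2.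
          C0 \<in> L_span E \<iota> [x \<otimes>\<^bsub>A\<^esub> y, x [^]\<^bsub>A\<^esub> (2::nat), y, x, \<one>\<^bsub>A\<^esub>] \<and>
          C1 \<in> L_span E \<iota> [x [^]\<^bsub>A\<^esub> (2::nat), y, x, \<one>\<^bsub>A\<^esub>] \<and>
          C2 \<in> L_span E \<iota> [x [^]\<^bsub>A\<^esub> (2::nat), x, \<one>\<^bsub>A\<^esub>] \<and>
          \<not> (C0 = \<zero>\<^bsub>A\<^esub> \<and> C1 = \<zero>\<^bsub>A\<^esub> \<and> C2 = \<zero>\<^bsub>A\<^esub>) \<and>
          C2 \<odot>\<^bsub>M\<^esub> (tau [^]\<^bsub>T\<^esub> (2::nat) \<otimes>\<^bsub>T\<^esub> s) =
            C1 \<odot>\<^bsub>M\<^esub> (tau \<otimes>\<^bsub>T\<^esub> s) \<oplus>\<^bsub>M\<^esub> C0 \<odot>\<^bsub>M\<^esub> s"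
proof -
  interpret twisted_hom E \<iota> \<phi> q
    by standard (fact q \<iota>_hom \<phi>_hom)+
  define EL where "EL = base_change E \<iota>"
  interpret A: cring "coord_ring EL"
    by (rule coord_ring_cring)
  define \<omega> :: "nat \<Rightarrow> 'l poly" where
    "\<omega> k = [motive_gen, twisted_mult q tau motive_gen,
      twisted_mult q (tau [^]\<^bsub>twisted_poly_ring q\<^esub> (2::nat)) motive_gen] ! k" for k
  \<comment> \<open>a pair \<open>(j, i)\<close> stands for \<open>x\<^sup>j y\<^sup>i\<close>\<close>
  define ms :: "nat \<Rightarrow> (nat \<times> nat) list" where
    "ms k = [[(1, 1), (2, 0), (0, 1), (1, 0), (0, 0)],
      [(2, 0), (0, 1), (1, 0), (0, 0)],
      [(2, 0), (1, 0), (0, 0)]] ! k" for k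
  have less_3: "k < 3 \<longleftrightarrow> k = 0 \<or> k = 1 \<or> k = 2" for k :: nat
    by auto
  have degree_tau: "degree (tau :: 'l poly) = 1" and degree_gen: "degree (motive_gen :: 'l poly) = 0"
    by (simp_all add: tau_def motive_gen_def)
  have degree_\<omega>: "degree (\<omega> k) \<le> k" if "k < 3" for k
    using that degree_twisted_mult_le[of q "tau :: 'l poly" motive_gen]
      degree_twisted_mult_le[of q "tau [^]\<^bsub>twisted_poly_ring q\<^esub> (2::nat) :: 'l poly" motive_gen]
      degree_twisted_power_le[of q "tau :: 'l poly" 2]
    by (auto simp: less_3 \<omega>_def degree_tau degree_gen)
  have distinct: "distinct (ms k)" and small: "(j, i) \<in> set (ms k) \<Longrightarrow> i < 2"
    and bound: "(j, i) \<in> set (ms k) \<Longrightarrow> k + j * 4 + i * 6 < 11" if "k < 3" for k j i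
    using that by (auto simp: less_3 ms_def)
  \<comment> \<open>the twisted degrees are at most \<open>10\<close>, and there are \<open>5 + 4 + 3 = 12\<close> products\<close>
  have "\<exists>c. (\<exists>k<3. \<exists>m\<in>set (ms k). c k m \<noteq> 0) \<and>
    (\<Sum>k<3. motive_act E \<phi> (monomial_sum (c k) (ms k)) (\<omega> k)) = 0"
  proof (rule motive_relation_of_bounded_degree)
    show "degree (\<omega> k) + j * degree (\<phi> (coord_x E)) + i * degree (\<phi> (coord_y E)) < 11"
      if "k < 3" and "(j, i) \<in> set (ms k)" for k j i
      using degree_\<omega>[OF that(1)] bound[OF that] by (simp add: \<phi>_x \<phi>_y)
    show "(\<Sum>k<3. length (ms k)) > 11"
      by (simp add: ms_def eval_nat_numeral)
  qed (fact distinct)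
  then obtain c where c_nonzero: "\<exists>k<3. \<exists>m\<in>set (ms k). c k m \<noteq> 0"
    and relation: "(\<Sum>k<3. motive_act E \<phi> (monomial_sum (c k) (ms k)) (\<omega> k)) = 0"
    by blast
  \<comment> \<open>signs that move the terms in \<open>s\<close> and \<open>\<tau> s\<close> to the right-hand side\<close>
  define b where "b k = (if k = 2 then c k else (\<lambda>m. - c k m))" for k
  define C where "C k = coord_class EL (monomial_sum (b k) (ms k))" for k
  have span: "C k \<in> L_span E \<iota> (map (\<lambda>m. coord_class EL (bimonom (fst m) (snd m))) (ms k))" for k
    using coord_class_combination_in_Span[of EL "b k" "\<lambda>m. bimonom (fst m) (snd m)" "ms k"]
    by (simp only: L_span_def C_def monomial_sum_def EL_def)
  have [simp]: "coord_x EL \<in> carrier (coord_ring EL)" "coord_y EL \<in> carrier (coord_ring EL)"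
    by (simp_all add: coord_x_def coord_y_def)
  have "C 0 \<in> L_span E \<iota> [coord_x EL \<otimes>\<^bsub>coord_ring EL\<^esub> coord_y EL,
      coord_x EL [^]\<^bsub>coord_ring EL\<^esub> (2::nat), coord_y EL, coord_x EL, \<one>\<^bsub>coord_ring EL\<^esub>]"
    using span[of 0] by (simp add: ms_def coord_class_bimonom)
  moreover have "C 1 \<in> L_span E \<iota> [coord_x EL [^]\<^bsub>coord_ring EL\<^esub> (2::nat), coord_y EL, coord_x EL,
      \<one>\<^bsub>coord_ring EL\<^esub>]"
    using span[of 1] by (simp add: ms_def coord_class_bimonom)
  moreover have "C 2 \<in> L_span E \<iota> [coord_x EL [^]\<^bsub>coord_ring EL\<^esub> (2::nat), coord_x EL,
      \<one>\<^bsub>coord_ring EL\<^esub>]"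
    using span[of 2] by (simp add: ms_def coord_class_bimonom)
  moreover have "\<not> (C 0 = \<zero>\<^bsub>coord_ring EL\<^esub> \<and> C 1 = \<zero>\<^bsub>coord_ring EL\<^esub> \<and> C 2 = \<zero>\<^bsub>coord_ring EL\<^esub>)"
  proof -
    obtain k m where k: "k < 3" and m: "m \<in> set (ms k)" "c k m \<noteq> 0"
      using c_nonzero by blast
    then have "b k m \<noteq> 0"
      by (cases "k = 2") (simp_all add: b_def)
    with m have "C k \<noteq> \<zero>\<^bsub>coord_ring EL\<^esub>"
      unfolding C_def
      by (subst coord_class_monomial_sum_eq_zero_iff) (auto intro: distinct[OF k] small[OF k])
    then show ?thesis
      using k by (auto simp: less_3)
  qed
  moreover have "C 2 \<odot>\<^bsub>anderson_motive E \<phi>\<^esub> \<omega> 2 =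
      C 1 \<odot>\<^bsub>anderson_motive E \<phi>\<^esub> \<omega> 1 \<oplus>\<^bsub>anderson_motive E \<phi>\<^esub> C 0 \<odot>\<^bsub>anderson_motive E \<phi>\<^esub> \<omega> 0"
  proof -
    have act: "C k \<odot>\<^bsub>anderson_motive E \<phi>\<^esub> \<omega> k = motive_act E \<phi> (monomial_sum (b k) (ms k)) (\<omega> k)" for k
      by (simp add: C_def EL_def anderson_motive_smult)
    have add: "f \<oplus>\<^bsub>anderson_motive E \<phi>\<^esub> g = f + g" for f g
      by (simp add: anderson_motive_def)
    have "motive_act E \<phi> (monomial_sum (c 0) (ms 0)) (\<omega> 0) +
        motive_act E \<phi> (monomial_sum (c 1) (ms 1)) (\<omega> 1) +
        motive_act E \<phi> (monomial_sum (c 2) (ms 2)) (\<omega> 2) = 0"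
      using relation by (simp add: eval_nat_numeral)
    then show ?thesis
      by (simp add: act add b_def motive_act_monomial_sum_minus eq_neg_iff_add_eq_0 algebra_simps)
  qed
  ultimately show ?thesis
    unfolding Let_def EL_def \<omega>_def
    by (intro exI[of _ "C 0"] exI[of _ "C 1"] exI[of _ "C 2"]) (simp add: EL_def)
qed

end
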